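(* Let $\Theta$ be a $2\times2$ inner function, let $\phi=\det\Theta$, and write $$\Theta(z)=\begin{pmatrix} a(z) & -b(z)\\ C(b)(z) & C(a)(z)\end{pmatrix},$$ where $C$ is the conjugation $C(f)=\overline f\,\phi$ on $H^2\ominus z\phi H^2$. Then $\Theta$ is symmetrizable if and only if there exist complex numbers $(\gamma,\theta)\neq(0,0)$ such that $\gamma a+\theta b$ is a fixed point of $C$, i.e. $C(\gamma a+\theta b)=\gamma a+\theta b$.
   Context: $\mathbb D$ is the open unit disc, $\mathbb T$ the unit circle, $H^2$ and $H^\infty$ the usual scalar Hardy spaces on $\mathbb D$, whose elements are identified with their boundary values on $\mathbb T$. A $2\times 2$ inner function is an analytic function $\Theta$ on $\mathbb D$ whose values are $2\times2$ complex matrices (operators on $\mathbb C^2$) with $\|\Theta(z)\|\le1$ for all $z\in\mathbb D$ and whose boundary values $\Theta(e^{it})$ are isometric for almost every $e^{it}\in\mathbb T$. Its determinant $\phi=\det\Theta$ is then a scalar inner function. For a scalar inner function $\phi$, the formula $C(f)=\overline f\,\phi$ (pointwise a.e. on $\mathbb T$) defines a conjugation, i.e. an anti-linear, isometric and involutive map, on the space $H^2\ominus z\phi H^2$. By a known parametrization of $2\times2$ inner functions (used with $\phi$ nonconstant), a matrix function $\begin{pmatrix} a&-b\\ c&d\end{pmatrix}$ with entries in $H^\infty$ is inner with determinant $\phi$ if and only if $a,b,c,d\in H^2\ominus z\phi H^2$, $d=C(a)$, $c=C(b)$, and $|a|^2+|b|^2=1$ a.e. on $\mathbb T$. A contractive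 analytic function $\Theta:\mathbb D\to\mathcal L(\mathcal E,\mathcal E_* )$ is symmetrizable if its matrix with respect to some fixed orthonormal bases (independent of $z$) of $\mathcal E$ and $\mathcal E_*$ is symmetric (equal to its transpose) for all $z\in\mathbb D$. For a $2\times2$ matrix-valued function this means: there exist constant unitary $2\times 2$ matrices $U_1,U_2$ such that $U_1\Theta(z)U_2$ is a symmetric matrix for all $z\in\mathbb D$. *)

theory Defs
  imports "HOL-Complex_Analysis.Complex_Analysis"
begin

abbreviation unit_disc :: "complex set" where
  "unit_disc \<equiv> ball 0 1"

text \<open>\<open>radial_lim F w L\<close>: the function \<open>F\<close> on the disc has the boundary value \<open>L\<close> at the
  point \<open>w\<close> of the unit circle. Boundary values are treated as a relation, so a statement about
  them includes the claim that they exist.\<close>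

definition radial_lim :: "(complex \<Rightarrow> 'a::topological_space) \<Rightarrow> complex \<Rightarrow> 'a \<Rightarrow> bool" where
  "radial_lim F w L \<longleftrightarrow> ((\<lambda>r::real. F (of_real r * w)) \<longlongrightarrow> L) (at_left 1)"

text \<open>``Almost everywhere on the circle'' is expressed as \<open>AE t in lborel. P (cis t)\<close>; by
  periodicity this is the same as almost everywhere with respect to arc length.\<close>

definition circle_mean :: "(complex \<Rightarrow> 'a::real_normed_vector) \<Rightarrow> 'a" where
  "circle_mean F = (1 / (2 * pi)) *\<^sub>R integral {0..2 * pi} (\<lambda>t. F (cis t))"

definition hardy2 :: "(complex \<Rightarrow> complex) set" where
  "hardy2 = {f. f holomorphic_on unit_disc \<and>
     bdd_above ((\<lambda>r::real. circle_mean (\<lambda>w. (cmod (f (of_real r * w)))\<^sup>2)) ` {0..<1})}"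

text \<open>The inner product of \<open>H\<^sup>2\<close>. Since the dilations of an \<open>H\<^sup>2\<close> function converge in
  \<open>L\<^sup>2\<close> of the circle to its boundary function, this limit exists for
  \<open>f\<close>, \<open>g\<close> in \<open>hardy2\<close> and is the \<open>L\<^sup>2\<close> inner product of the boundary functions.\<close>

definition hardy2_inner :: "(complex \<Rightarrow> complex) \<Rightarrow> (complex \<Rightarrow> complex) \<Rightarrow> complex" where
  "hardy2_inner f g =
     Lim (at_left (1::real)) (\<lambda>r. circle_mean (\<lambda>w. f (of_real r * w) * cnj (g (of_real r * w))))"

text \<open>The space \<open>H\<^sup>2 \<ominus> z \<phi> H\<^sup>2\<close>.\<close>

definition model_space :: "(complex \<Rightarrow> complex) \<Rightarrow> (complex \<Rightarrow> complex) set" where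
  "model_space \<phi> = {f \<in> hardy2. \<forall>h \<in> hardy2. hardy2_inner f (\<lambda>z. z * \<phi> z * h z) = 0}"

text \<open>The conjugation \<open>C(f) = cnj f * \<phi>\<close> (a.e. on the circle), as a map on functions on the disc:
  \<open>conj_map \<phi> f\<close> is the element of \<open>model_space \<phi>\<close> with these boundary values. An \<open>H\<^sup>2\<close>
  function is determined on the disc by its boundary values, but not outside of it, so that
  \<open>conj_map \<phi> f z\<close> is meaningful only for \<open>z\<close> in the disc.\<close>

definition conj_map :: "(complex \<Rightarrow> complex) \<Rightarrow> (complex \<Rightarrow> complex) \<Rightarrow> complex \<Rightarrow> complex" where
  "conj_map \<phi> f = (SOME g. g \<in> model_space \<phi> \<and>
     (AE t in lborel. \<exists>u p. radial_lim f (cis t) u \<and> radial_lim \<phi> (cis t) p \<and>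
                            radial_lim g (cis t) (cnj u * p)))"

definition inner_matrix_fun :: "(complex \<Rightarrow> complex^2^2) \<Rightarrow> bool" where
  "inner_matrix_fun \<Theta> \<longleftrightarrow>
     (\<forall>i j. (\<lambda>z. \<Theta> z $ i $ j) holomorphic_on unit_disc) \<and>
     (\<forall>z \<in> unit_disc. onorm (\<lambda>v. \<Theta> z *v v) \<le> 1) \<and>
     (AE t in lborel. \<exists>L. radial_lim \<Theta> (cis t) L \<and> (\<forall>v. norm (L *v v) = norm v))"

definition adjoint_matrix :: "complex^2^2 \<Rightarrow> complex^2^2" where
  "adjoint_matrix A = (\<chi> i j. cnj (A $ j $ i))"

definition unitary_matrix :: "complex^2^2 \<Rightarrow> bool" where
  "unitary_matrix U \<longleftrightarrow> adjoint_matrix U ** U = mat 1 \<and> U ** adjoint_matrix U = mat 1"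

definition symmetrizable :: "(complex \<Rightarrow> complex^2^2) \<Rightarrow> bool" where
  "symmetrizable \<Theta> \<longleftrightarrow>
     (\<exists>U1 U2. unitary_matrix U1 \<and> unitary_matrix U2 \<and>
       (\<forall>z \<in> unit_disc. transpose (U1 ** \<Theta> z ** U2) = U1 ** \<Theta> z ** U2))"

end

theory Submission
  imports Defs
begin

text \<open>A congruence \<open>M \<mapsto> P ** M ** transpose P\<close> preserves symmetry. Taking for \<open>P\<close> the inverse of
  the transpose of \<open>U2\<close>, one sees that \<open>\<Theta>\<close> is symmetrizable iff \<open>V ** \<Theta>\<close> is symmetric for a single
  unitary \<open>V\<close> (\<open>symmetrizable_iff_left\<close>). A \<open>2\<times>2\<close> unitary matrix is given by its first row \<open>(p, q)\<close>
  and its determinant \<open>e\<close>, its second row being \<open>(- e * cnj q, e * cnj p)\<close>. So symmetry of \<open>V ** \<Theta>\<close>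
  is one linear equation between \<open>a\<close>, \<open>b\<close>, \<open>C(a)\<close> and \<open>C(b)\<close>. Multiplied by a unimodular \<open>l\<close> with
  \<open>l\<^sup>2 = - cnj e\<close>, it becomes \<open>cnj \<gamma> C(a) + cnj \<theta> C(b) = \<gamma> a + \<theta> b\<close>, where \<open>\<gamma> = cnj (l q)\<close> and
  \<open>\<theta> = l p\<close>. Conversely, any nonzero \<open>(\<gamma>, \<theta>)\<close> can be divided by its norm and completed to such a
  \<open>V\<close> (\<open>exists_unitary_symmetric_iff\<close>).

  What remains is that \<open>C(\<gamma> a + \<theta> b) = cnj \<gamma> C(a) + cnj \<theta> C(b)\<close> on the disc. The entries of \<open>\<Theta>\<close> are
  bounded by \<open>1\<close>, and its boundary values are isometric, hence unitary with determinant the boundary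
  value of \<open>\<phi>\<close>; this gives the boundary values of \<open>C(a)\<close> and \<open>C(b)\<close>, and with them those of the
  right-hand side. A bounded analytic function with boundary values \<open>cnj F * \<phi>\<close>, for a bounded \<open>F\<close>,
  lies in the model space (\<open>bounded_conjugate_in_model_space\<close>), and an \<open>H\<^sup>2\<close> function is determined
  by its radial limits (\<open>hardy2_eq_0_if_radial_lim_0\<close>), so it is the value of \<open>C\<close> at \<open>F\<close>
  (\<open>conj_map_bounded\<close>). Both facts rest on one limit theorem: the product of a bounded family that
  tends to \<open>0\<close> a.e. with an \<open>L\<^sup>2\<close>-bounded family tends to \<open>0\<close> in \<open>L\<^sup>1\<close>
  (\<open>integral_bounded_times_L2_tendsto_0\<close>).\<close>

(* In this theory $ selects vector components only. *)
no_notation fps_nth (infixl "$" 75)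

section \<open>Integrals over circles approaching the unit circle\<close>

lemma continuous_on_circle:
  assumes "f holomorphic_on unit_disc" "0 \<le> r" "r < 1"
  shows "continuous_on S (\<lambda>t. f (of_real r * cis t))"
proof -
  have "continuous_on unit_disc f"
    using assms(1) by (rule holomorphic_on_imp_continuous_on)
  moreover have "continuous_on S (\<lambda>t. of_real r * cis t)"
    by (intro continuous_intros)
  moreover have "(\<lambda>t. of_real r * cis t) ` S \<subseteq> unit_disc"
    using assms by (auto simp: norm_mult)
  ultimately show ?thesis
    by (rule continuous_on_compose2)
qed

lemma radial_lim_unique:
  fixes f :: "complex \<Rightarrow> complex"
  assumes "radial_lim f w x" "radial_lim f w y"
  shows "x = y"
  using assms tendsto_unique[OF trivial_limit_at_left_real] unfolding radial_lim_def by blast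

lemma bounded_convergence_at_left:
  fixes u :: "real \<Rightarrow> real \<Rightarrow> real"
  assumes cont: "\<And>r. 0 < r \<Longrightarrow> r < 1 \<Longrightarrow> continuous_on {a..b} (u r)"
    and bound: "\<And>r t. 0 < r \<Longrightarrow> r < 1 \<Longrightarrow> \<bar>u r t\<bar> \<le> M"
    and lim: "AE t in lborel. ((\<lambda>r. u r t) \<longlongrightarrow> 0) (at_left 1)"
  shows "((\<lambda>r. integral {a..b} (u r)) \<longlongrightarrow> 0) (at_left 1)"
proof (rule tendsto_at_left_sequentially)
  show "(0::real) < 1" by simp
next
  fix S :: "nat \<Rightarrow> real"
  assume S: "\<And>n. S n < 1" "\<And>n. 0 < S n" "S \<longlonglongrightarrow> 1"
  have S_lim: "filterlim S (at_left 1) sequentially"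
    using S by (intro tendsto_imp_filterlim_at_left) auto
  have int: "set_integrable lborel {a..b} (u (S n))" for n
    using S by (intro borel_integrable_atLeastAtMost' cont)
  have "(\<lambda>n. LINT t|lborel. indicator {a..b} t *\<^sub>R u (S n) t) \<longlonglongrightarrow> (LINT (t::real)|lborel. (0::real))"
  proof (rule integral_dominated_convergence)
    show "integrable lborel (\<lambda>t. indicator {a..b} t *\<^sub>R M)"
      using borel_integrable_atLeastAtMost'[of a b "\<lambda>_. M"] by (simp add: set_integrable_def)
    show "AE t in lborel. (\<lambda>n. indicator {a..b} t *\<^sub>R u (S n) t) \<longlonglongrightarrow> 0"
      using lim
    proof eventually_elim
      case (elim t)
      from filterlim_compose[OF elim S_lim] have "(\<lambda>n. u (S n) t) \<longlonglongrightarrow> 0" .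
      from tendsto_scaleR[OF tendsto_const[of "indicator {a..b} t :: real"] this]
      show ?case by simp
    qed
    show "AE t in lborel. norm (indicator {a..b} t *\<^sub>R u (S n) t) \<le> indicator {a..b} t *\<^sub>R M" for n
      using bound[OF S(2) S(1)] by (intro AE_I2) (auto simp: indicator_def)
    show "(\<lambda>t. indicator {a..b} t *\<^sub>R u (S n) t) \<in> borel_measurable lborel" for n
      using int[of n] by (simp add: set_integrable_def)
  qed auto
  moreover have "(LINT t|lborel. indicator {a..b} t *\<^sub>R u (S n) t) = integral {a..b} (u (S n))" for n
    using set_borel_integral_eq_integral(2)[OF int[of n]] by (simp add: set_lebesgue_integral_def)
  ultimately show "(\<lambda>n. integral {a..b} (u (S n))) \<longlonglongrightarrow> 0"
    by simp
qed

text \<open>By dominated convergence \<open>e r\<close> tends to \<open>0\<close> in \<open>L\<^sup>2\<close>, so this is the Cauchy--Schwarz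
  inequality, here in the form of a weighted bound for \<open>\<bar>e * h\<bar>\<close> by squares.\<close>

lemma integral_bounded_times_L2_tendsto_0:
  fixes e h :: "real \<Rightarrow> real \<Rightarrow> real"
  assumes e: "\<And>r. 0 < r \<Longrightarrow> r < 1 \<Longrightarrow> continuous_on {a..b} (e r)"
    and h: "\<And>r. 0 < r \<Longrightarrow> r < 1 \<Longrightarrow> continuous_on {a..b} (h r)"
    and bound: "\<And>r t. 0 < r \<Longrightarrow> r < 1 \<Longrightarrow> \<bar>e r t\<bar> \<le> M"
    and L2: "\<And>r. 0 < r \<Longrightarrow> r < 1 \<Longrightarrow> integral {a..b} (\<lambda>t. (h r t)\<^sup>2) \<le> K"
    and lim: "AE t in lborel. ((\<lambda>r. e r t) \<longlongrightarrow> 0) (at_left 1)"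
  shows "((\<lambda>r. integral {a..b} (\<lambda>t. \<bar>e r t\<bar> * \<bar>h r t\<bar>)) \<longlongrightarrow> 0) (at_left 1)"
proof -
  have sq: "((\<lambda>r. integral {a..b} (\<lambda>t. (e r t)\<^sup>2)) \<longlongrightarrow> 0) (at_left 1)"
  proof (rule bounded_convergence_at_left)
    show "continuous_on {a..b} (\<lambda>t. (e r t)\<^sup>2)" if "0 < r" "r < 1" for r
      using that by (intro continuous_intros e)
    show "\<bar>(e r t)\<^sup>2\<bar> \<le> M\<^sup>2" if "0 < r" "r < 1" for r t
      using bound[OF that, of t] power_mono[of "\<bar>e r t\<bar>" M 2] by simp
    show "AE t in lborel. ((\<lambda>r. (e r t)\<^sup>2) \<longlongrightarrow> 0) (at_left 1)"
      using lim by eventually_elim (auto intro: tendsto_eq_intros)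
  qed
  have near: "\<forall>\<^sub>F r in at_left (1::real). 0 < r \<and> r < 1"
    using eventually_at_left_real[of 0 1] by simp
  show ?thesis
  proof (rule tendstoI)
    fix x :: real assume "0 < x"
    \<comment> \<open>\<open>\<bar>e h\<bar> \<le> \<delta> h\<^sup>2 + e\<^sup>2 / \<delta>\<close>, where \<open>\<delta>\<close> makes the first integral at most \<open>x / 2\<close>.\<close>
    define \<delta> where "\<delta> = x / (2 * (\<bar>K\<bar> + 1))"
    have \<delta>: "0 < \<delta>" "\<delta> * K \<le> x / 2"
    proof -
      show "0 < \<delta>" using \<open>0 < x\<close> by (simp add: \<delta>_def)
      have "\<delta> * K \<le> \<delta> * (\<bar>K\<bar> + 1)"
        using \<open>0 < \<delta>\<close> by (intro mult_left_mono) auto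
      also have "\<dots> = x / 2" by (simp add: \<delta>_def field_simps)
      finally show "\<delta> * K \<le> x / 2" .
    qed
    have "\<forall>\<^sub>F r in at_left 1. integral {a..b} (\<lambda>t. (e r t)\<^sup>2) < \<delta> * (x / 2)"
      using sq \<delta> \<open>0 < x\<close> by (intro order_tendstoD) auto
    then show "\<forall>\<^sub>F r in at_left 1.
        dist (integral {a..b} (\<lambda>t. \<bar>e r t\<bar> * \<bar>h r t\<bar>)) 0 < x"
      using near
    proof eventually_elim
      case (elim r)
      then have r: "0 < r" "r < 1" by auto
      note ce = e[OF r] and ch = h[OF r]
      have "integral {a..b} (\<lambda>t. \<bar>e r t\<bar> * \<bar>h r t\<bar>)
          \<le> integral {a..b} (\<lambda>t. \<delta> * (h r t)\<^sup>2 + (e r t)\<^sup>2 / \<delta>)"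
      proof (rule integral_le)
        show "\<bar>e r t\<bar> * \<bar>h r t\<bar> \<le> \<delta> * (h r t)\<^sup>2 + (e r t)\<^sup>2 / \<delta>" for t
        proof -
          have "\<delta> * (\<bar>e r t\<bar> * \<bar>h r t\<bar>) \<le> (\<delta> * \<bar>h r t\<bar>)\<^sup>2 + \<bar>e r t\<bar>\<^sup>2"
          proof -
            have "0 \<le> \<delta> * (\<bar>e r t\<bar> * \<bar>h r t\<bar>)"
              using \<delta> by simp
            moreover have "2 * (\<delta> * (\<bar>e r t\<bar> * \<bar>h r t\<bar>)) \<le> (\<delta> * \<bar>h r t\<bar>)\<^sup>2 + \<bar>e r t\<bar>\<^sup>2"
              using sum_squares_bound[of "\<delta> * \<bar>h r t\<bar>" "\<bar>e r t\<bar>"] by (simp add: ac_simps)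
            ultimately show ?thesis by linarith
          qed
          also have "\<dots> = \<delta> * (\<delta> * (h r t)\<^sup>2 + (e r t)\<^sup>2 / \<delta>)"
            using \<delta> by (simp add: field_simps power2_eq_square)
          finally show ?thesis using \<delta> by simp
        qed
      qed (use \<delta> in \<open>auto intro!: integrable_continuous_real continuous_intros ce ch\<close>)
      also have "\<dots> = \<delta> * integral {a..b} (\<lambda>t. (h r t)\<^sup>2) + integral {a..b} (\<lambda>t. (e r t)\<^sup>2) / \<delta>"
      proof -
        have "integral {a..b} (\<lambda>t. \<delta> * (h r t)\<^sup>2 + (e r t)\<^sup>2 / \<delta>)
            = integral {a..b} (\<lambda>t. \<delta> * (h r t)\<^sup>2) + integral {a..b} (\<lambda>t. (e r t)\<^sup>2 / \<delta>)"
          using \<delta> by (intro integral_add integrable_continuous_real continuous_intros ce ch) auto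
        then show ?thesis by simp
      qed
      also have "\<dots> < x"
      proof -
        have "\<delta> * integral {a..b} (\<lambda>t. (h r t)\<^sup>2) \<le> \<delta> * K"
          using L2[OF r] \<delta> by simp
        moreover have "integral {a..b} (\<lambda>t. (e r t)\<^sup>2) / \<delta> < x / 2"
          using elim \<delta> by (simp add: field_simps)
        ultimately show ?thesis using \<delta> by linarith
      qed
      finally have "integral {a..b} (\<lambda>t. \<bar>e r t\<bar> * \<bar>h r t\<bar>) < x" .
      moreover have "0 \<le> integral {a..b} (\<lambda>t. \<bar>e r t\<bar> * \<bar>h r t\<bar>)"
        by (intro integral_nonneg integrable_continuous_real continuous_intros ce ch) auto
      ultimately show ?case by simp
    qed
  qed
qed

section \<open>Hardy functions\<close>

lemma hardy2_iff:
  "f \<in> hardy2 \<longleftrightarrow> f holomorphic_on unit_disc \<and>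
     (\<exists>K. \<forall>r. 0 \<le> r \<and> r < 1 \<longrightarrow>
        integral {0..2 * pi} (\<lambda>t. (cmod (f (of_real r * cis t)))\<^sup>2) \<le> K)"
proof -
  have "bdd_above ((\<lambda>r::real. circle_mean (\<lambda>w. (cmod (f (of_real r * w)))\<^sup>2)) ` {0..<1}) \<longleftrightarrow>
    (\<exists>K. \<forall>r. 0 \<le> r \<and> r < 1 \<longrightarrow> integral {0..2 * pi} (\<lambda>t. (cmod (f (of_real r * cis t)))\<^sup>2) \<le> K)"
    (is "?L \<longleftrightarrow> (\<exists>K. ?R K)")
  proof
    assume ?L
    then obtain K where "\<And>r. 0 \<le> r \<Longrightarrow> r < 1 \<Longrightarrow>
        circle_mean (\<lambda>w. (cmod (f (of_real r * w)))\<^sup>2) \<le> K"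
      unfolding bdd_above_def ball_simps by (metis atLeastLessThan_iff)
    then have "?R (2 * pi * K)"
      by (auto simp: circle_mean_def field_simps)
    then show "\<exists>K. ?R K" ..
  next
    assume "\<exists>K. ?R K"
    then obtain K where "?R K" ..
    then have "\<forall>x\<in>(\<lambda>r::real. circle_mean (\<lambda>w. (cmod (f (of_real r * w)))\<^sup>2)) ` {0..<1}. x \<le> K / (2 * pi)"
      by (auto simp: circle_mean_def field_simps)
    then show ?L by (auto simp: bdd_above_def)
  qed
  then show ?thesis by (simp add: hardy2_def)
qed

lemma bounded_holomorphic_in_hardy2:
  assumes "f holomorphic_on unit_disc" "\<And>z. z \<in> unit_disc \<Longrightarrow> cmod (f z) \<le> M"
  shows "f \<in> hardy2"
proof -
  have "integral {0..2 * pi} (\<lambda>t. (cmod (f (of_real r * cis t)))\<^sup>2) \<le> integral {0..2 * pi} (\<lambda>t. M\<^sup>2)"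
    if "0 \<le> r" "r < 1" for r
  proof (rule integral_le)
    show "(cmod (f (of_real r * cis t)))\<^sup>2 \<le> M\<^sup>2" for t
      using that by (intro power_mono assms(2)) (auto simp: norm_mult)
  qed (use that in \<open>auto intro!: integrable_continuous_real continuous_intros
                        continuous_on_circle assms(1)\<close>)
  then show ?thesis
    unfolding hardy2_iff using assms(1) by blast
qed

lemma hardy2_diff:
  assumes "f \<in> hardy2" "g \<in> hardy2"
  shows "(\<lambda>z. f z - g z) \<in> hardy2"
proof -
  from assms obtain K L where hol: "f holomorphic_on unit_disc" "g holomorphic_on unit_disc"
    and K: "\<And>r. 0 \<le> r \<Longrightarrow> r < 1 \<Longrightarrow> integral {0..2 * pi} (\<lambda>t. (cmod (f (of_real r * cis t)))\<^sup>2) \<le> K"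
    and L: "\<And>r. 0 \<le> r \<Longrightarrow> r < 1 \<Longrightarrow> integral {0..2 * pi} (\<lambda>t. (cmod (g (of_real r * cis t)))\<^sup>2) \<le> L"
    unfolding hardy2_iff by metis
  have "integral {0..2 * pi} (\<lambda>t. (cmod (f (of_real r * cis t) - g (of_real r * cis t)))\<^sup>2)
      \<le> 2 * K + 2 * L" if r: "0 \<le> r" "r < 1" for r
  proof -
    note cf = continuous_on_circle[OF hol(1) r] and cg = continuous_on_circle[OF hol(2) r]
    have "integral {0..2 * pi} (\<lambda>t. (cmod (f (of_real r * cis t) - g (of_real r * cis t)))\<^sup>2)
       \<le> integral {0..2 * pi} (\<lambda>t. 2 * (cmod (f (of_real r * cis t)))\<^sup>2
            + 2 * (cmod (g (of_real r * cis t)))\<^sup>2)"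
    proof (rule integral_le)
      have "(cmod (u - v))\<^sup>2 \<le> 2 * (cmod u)\<^sup>2 + 2 * (cmod v)\<^sup>2" for u v
      proof -
        have "(cmod (u - v))\<^sup>2 \<le> (cmod u + cmod v)\<^sup>2"
          by (intro power_mono norm_triangle_ineq4) auto
        also have "\<dots> \<le> 2 * (cmod u)\<^sup>2 + 2 * (cmod v)\<^sup>2"
          using sum_squares_bound[of "cmod u" "cmod v"] by (simp add: power2_sum)
        finally show ?thesis .
      qed
      then show "(cmod (f (of_real r * cis t) - g (of_real r * cis t)))\<^sup>2
          \<le> 2 * (cmod (f (of_real r * cis t)))\<^sup>2 + 2 * (cmod (g (of_real r * cis t)))\<^sup>2" for t .
    qed (auto intro!: integrable_continuous_real continuous_intros cf cg)
    also have "\<dots> = 2 * integral {0..2 * pi} (\<lambda>t. (cmod (f (of_real r * cis t)))\<^sup>2)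
            + 2 * integral {0..2 * pi} (\<lambda>t. (cmod (g (of_real r * cis t)))\<^sup>2)"
      by (subst integral_add)
         (auto intro!: integrable_continuous_real continuous_intros cf cg)
    also have "\<dots> \<le> 2 * K + 2 * L"
      using K[OF r] L[OF r] by simp
    finally show ?thesis .
  qed
  then show ?thesis
    unfolding hardy2_iff using hol by (auto intro!: holomorphic_intros)
qed

lemma circle_mean_eq_centre:
  assumes "f holomorphic_on unit_disc" "0 < r" "r < 1"
  shows "circle_mean (\<lambda>w. f (of_real r * w)) = f 0"
proof -
  have "cball 0 r \<subseteq> unit_disc" using assms by auto
  then have "f holomorphic_on cball 0 r"
    using assms(1) holomorphic_on_subset by blast
  then have "((\<lambda>w. f w / (w - 0)) has_contour_integral (2 * of_real pi * \<i> * f 0)) (circlepath 0 r)"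
    using assms by (intro Cauchy_integral_circlepath_simple) auto
  then have "((\<lambda>t. f (of_real r * cis t) / (of_real r * cis t) * of_real r * \<i> * cis t)
      has_integral (2 * of_real pi * \<i> * f 0)) {0..2 * pi}"
    unfolding circlepath_def by (subst (asm) has_contour_integral_part_circlepath_iff) auto
  then have "((\<lambda>t. \<i> * f (of_real r * cis t)) has_integral (2 * of_real pi * \<i> * f 0)) {0..2 * pi}"
    using assms by (simp add: field_simps)
  from has_integral_mult_right[OF this, of "- \<i>"]
  have "((\<lambda>t. - \<i> * (\<i> * f (of_real r * cis t)))
      has_integral (- \<i> * (2 * of_real pi * \<i> * f 0))) {0..2 * pi}" .
  moreover have "- \<i> * (\<i> * x) = x" "- \<i> * (2 * of_real pi * \<i> * x) = 2 * of_real pi * x" for x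
    by (simp_all add: mult.assoc[symmetric])
  ultimately have "((\<lambda>t. f (of_real r * cis t)) has_integral (2 * of_real pi * f 0)) {0..2 * pi}"
    by (simp only:)
  then show ?thesis
    unfolding circle_mean_def by (simp add: integral_unique scaleR_conv_of_real)
qed

text \<open>The dilations of \<open>g\<close> are bounded in \<open>L\<^sup>2\<close>, hence uniformly integrable. Since they tend to
  \<open>0\<close> a.e., they tend to \<open>0\<close> in \<open>L\<^sup>1\<close> of the circle, and Cauchy's formula on circles growing to the
  unit circle carries this over to the point \<open>z\<close>.\<close>

lemma hardy2_eq_0_if_radial_lim_0:
  assumes g: "g \<in> hardy2" and lim: "AE t in lborel. radial_lim g (cis t) 0"
    and z: "z \<in> unit_disc"
  shows "g z = 0"
proof -
  from g obtain K where hol: "g holomorphic_on unit_disc"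
    and K: "\<And>r. 0 \<le> r \<Longrightarrow> r < 1 \<Longrightarrow> integral {0..2 * pi} (\<lambda>t. (cmod (g (of_real r * cis t)))\<^sup>2) \<le> K"
    unfolding hardy2_iff by metis
  let ?g = "\<lambda>r t. cmod (g (of_real r * cis t))"
  let ?e = "\<lambda>r t. ?g r t / (1 + ?g r t)"
  have pos: "1 + cmod w \<noteq> 0" for w
    using norm_ge_zero[of w] by linarith
  have cont: "continuous_on {0..2 * pi} (?g r)" if "0 < r" "r < 1" for r
    using that by (intro continuous_intros continuous_on_circle hol) auto
  \<comment> \<open>\<open>\<bar>g\<bar>\<close> is the product of \<open>\<bar>g\<bar> / (1 + \<bar>g\<bar>) \<le> 1\<close>, which tends to \<open>0\<close>, and of
    \<open>1 + \<bar>g\<bar>\<close>, whose dilations are bounded in \<open>L\<^sup>2\<close>.\<close>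
  have "((\<lambda>r. integral {0..2 * pi} (\<lambda>t. \<bar>?e r t\<bar> * \<bar>1 + ?g r t\<bar>)) \<longlongrightarrow> 0) (at_left 1)"
  proof (rule integral_bounded_times_L2_tendsto_0)
    fix r :: real assume r: "0 < r" "r < 1"
    note c = cont[OF r]
    show "continuous_on {0..2 * pi} (?e r)"
      using pos by (intro continuous_intros c) blast
    show "continuous_on {0..2 * pi} (\<lambda>t. 1 + ?g r t)"
      by (intro continuous_intros c)
    show "\<bar>?e r t\<bar> \<le> 1" for t
      by (simp add: abs_divide divide_le_eq_1 add_pos_nonneg)
    have "integral {0..2 * pi} (\<lambda>t. (1 + ?g r t)\<^sup>2)
        \<le> integral {0..2 * pi} (\<lambda>t. 2 + 2 * (?g r t)\<^sup>2)"
    proof (rule integral_le)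
      show "(1 + ?g r t)\<^sup>2 \<le> 2 + 2 * (?g r t)\<^sup>2" for t
        using sum_squares_bound[of 1 "?g r t"] by (simp add: power2_sum)
    qed (auto intro!: integrable_continuous_real continuous_intros c)
    also have "\<dots> = 4 * pi + 2 * integral {0..2 * pi} (\<lambda>t. (?g r t)\<^sup>2)"
      by (subst integral_add) (auto intro!: integrable_continuous_real continuous_intros c)
    also have "\<dots> \<le> 4 * pi + 2 * K"
      using K[of r] r by simp
    finally show "integral {0..2 * pi} (\<lambda>t. (1 + ?g r t)\<^sup>2) \<le> 4 * pi + 2 * K" .
  next
    show "AE t in lborel. ((\<lambda>r. ?e r t) \<longlongrightarrow> 0) (at_left 1)"
      using lim
    proof eventually_elim
      case (elim t)
      then have "((\<lambda>r. g (of_real r * cis t)) \<longlongrightarrow> 0) (at_left 1)"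
        by (simp add: radial_lim_def)
      then have "((\<lambda>r. ?g r t) \<longlongrightarrow> 0) (at_left 1)"
        by (rule tendsto_norm_zero)
      from tendsto_divide[OF this tendsto_add[OF tendsto_const[of 1] this]]
      show ?case by simp
    qed
  qed
  moreover have "\<bar>?e r t\<bar> * \<bar>1 + ?g r t\<bar> = ?g r t" for r t
    using pos[of "g (of_real r * cis t)"] by (simp add: abs_mult[symmetric])
  ultimately have L1: "((\<lambda>r. integral {0..2 * pi} (?g r)) \<longlongrightarrow> 0) (at_left 1)"
    by simp
  have bound: "cmod (g z) \<le> 1 / (r - cmod z) * integral {0..2 * pi} (?g r)"
    if r: "cmod z < r" "r < 1" for r
  proof -
    have "0 < r" using r norm_ge_zero[of z] by linarith
    note c = cont[OF \<open>0 < r\<close> \<open>r < 1\<close>]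
    have "cball 0 r \<subseteq> unit_disc" using r by auto
    then have "g holomorphic_on cball 0 r"
      using hol holomorphic_on_subset by blast
    then have "((\<lambda>w. g w / (w - z)) has_contour_integral (2 * of_real pi * \<i> * g z)) (circlepath 0 r)"
      using r by (intro Cauchy_integral_circlepath_simple) auto
    then have I: "((\<lambda>t. g (of_real r * cis t) / (of_real r * cis t - z) * of_real r * \<i> * cis t)
        has_integral (2 * of_real pi * \<i> * g z)) {0..2 * pi}"
      unfolding circlepath_def by (subst (asm) has_contour_integral_part_circlepath_iff) auto
    have "cmod (integral {0..2 * pi}
          (\<lambda>t. g (of_real r * cis t) / (of_real r * cis t - z) * of_real r * \<i> * cis t))
        \<le> integral {0..2 * pi} (\<lambda>t. 1 / (r - cmod z) * ?g r t)"
    proof (rule integral_norm_bound_integral)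
      fix t
      have "r - cmod z \<le> cmod (of_real r * cis t - z)"
        using norm_triangle_ineq2[of "of_real r * cis t" z] \<open>0 < r\<close> by (simp add: norm_mult)
      then have "?g r t / cmod (of_real r * cis t - z) * r \<le> ?g r t / (r - cmod z) * 1"
        using r \<open>0 < r\<close> by (intro mult_mono divide_left_mono mult_pos_pos) auto
      then show "cmod (g (of_real r * cis t) / (of_real r * cis t - z) * of_real r * \<i> * cis t)
          \<le> 1 / (r - cmod z) * ?g r t"
        using \<open>0 < r\<close> by (simp add: norm_mult norm_divide)
    next
      show "(\<lambda>t. g (of_real r * cis t) / (of_real r * cis t - z) * of_real r * \<i> * cis t)
          integrable_on {0..2 * pi}"
        using I by blast
      show "(\<lambda>t. 1 / (r - cmod z) * ?g r t) integrable_on {0..2 * pi}"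
        by (intro integrable_continuous_real continuous_intros c)
    qed
    also have "\<dots> = 1 / (r - cmod z) * integral {0..2 * pi} (?g r)"
      by simp
    also have "cmod (integral {0..2 * pi}
          (\<lambda>t. g (of_real r * cis t) / (of_real r * cis t - z) * of_real r * \<i> * cis t))
        = 2 * pi * cmod (g z)"
      using integral_unique[OF I] by (simp add: norm_mult)
    finally have "2 * pi * cmod (g z) \<le> 1 / (r - cmod z) * integral {0..2 * pi} (?g r)" .
    moreover have "1 * cmod (g z) \<le> 2 * pi * cmod (g z)"
      using pi_gt3 by (intro mult_right_mono) auto
    ultimately show ?thesis by linarith
  qed
  have "((\<lambda>r. 1 / (r - cmod z) * integral {0..2 * pi} (?g r)) \<longlongrightarrow> 1 / (1 - cmod z) * 0) (at_left 1)"
    using z by (intro tendsto_intros L1) auto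
  moreover have "\<forall>\<^sub>F r in at_left 1. cmod (g z) \<le> 1 / (r - cmod z) * integral {0..2 * pi} (?g r)"
  proof -
    have "\<forall>\<^sub>F r in at_left 1. r \<in> {cmod z<..<1}"
      using z by (intro eventually_at_left_real) auto
    then show ?thesis
      by (rule eventually_mono) (rule bound; simp)
  qed
  ultimately have "cmod (g z) \<le> 1 / (1 - cmod z) * 0"
    by (rule tendsto_lowerbound) (rule trivial_limit_at_left_real)
  then show ?thesis by simp
qed

section \<open>The conjugation on bounded functions\<close>

text \<open>On the circle \<open>G * cnj (z * \<phi> * h) = cnj (F * z * h)\<close>, because \<open>cmod \<phi> = 1\<close> there, and
  \<open>F * z * h\<close> has mean \<open>0\<close> as it vanishes at the origin. On a smaller circle the first equation
  holds up to an error that tends to \<open>0\<close> as the radius tends to \<open>1\<close>.\<close>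

lemma bounded_conjugate_in_model_space:
  assumes F: "F holomorphic_on unit_disc" "\<And>z. z \<in> unit_disc \<Longrightarrow> cmod (F z) \<le> A"
    and G: "G holomorphic_on unit_disc" "\<And>z. z \<in> unit_disc \<Longrightarrow> cmod (G z) \<le> B"
    and \<phi>: "\<phi> holomorphic_on unit_disc" "\<And>z. z \<in> unit_disc \<Longrightarrow> cmod (\<phi> z) \<le> M"
    and boundary: "AE t in lborel. \<exists>u p. radial_lim F (cis t) u \<and> radial_lim \<phi> (cis t) p \<and>
          cmod p = 1 \<and> radial_lim G (cis t) (cnj u * p)"
  shows "G \<in> model_space \<phi>"
proof -
  have "hardy2_inner G (\<lambda>z. z * \<phi> z * h z) = 0" if "h \<in> hardy2" for h
  proof -
    from that obtain K where h: "h holomorphic_on unit_disc"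
      and K: "\<And>r. 0 \<le> r \<Longrightarrow> r < 1 \<Longrightarrow> integral {0..2 * pi} (\<lambda>t. (cmod (h (of_real r * cis t)))\<^sup>2) \<le> K"
      using hardy2_iff[of h] by blast
    let ?k = "\<lambda>r t. G (of_real r * cis t) * cnj (\<phi> (of_real r * cis t)) - cnj (F (of_real r * cis t))"
    have disc: "of_real r * cis t \<in> unit_disc" if "0 < r" "r < 1" for r t
      using that by (simp add: norm_mult)
    have cont: "continuous_on {0..2 * pi} (\<lambda>t. F (of_real r * cis t))"
        "continuous_on {0..2 * pi} (\<lambda>t. G (of_real r * cis t))"
        "continuous_on {0..2 * pi} (\<lambda>t. \<phi> (of_real r * cis t))"
        "continuous_on {0..2 * pi} (\<lambda>t. h (of_real r * cis t))" if "0 < r" "r < 1" for r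
      using that F(1) G(1) \<phi>(1) h by (auto intro!: continuous_on_circle)
    \<comment> \<open>\<open>?k\<close> measures the failure of \<open>G * cnj \<phi> = cnj F\<close> inside the disc.\<close>
    have lim: "((\<lambda>r. integral {0..2 * pi} (\<lambda>t. \<bar>cmod (?k r t)\<bar> * \<bar>cmod (h (of_real r * cis t))\<bar>))
        \<longlongrightarrow> 0) (at_left 1)"
    proof (rule integral_bounded_times_L2_tendsto_0)
      fix r :: real assume r: "0 < r" "r < 1"
      note c = cont[OF r]
      show "continuous_on {0..2 * pi} (\<lambda>t. cmod (?k r t))"
        by (intro continuous_intros c)
      show "continuous_on {0..2 * pi} (\<lambda>t. cmod (h (of_real r * cis t)))"
        by (intro continuous_intros c)
      show "integral {0..2 * pi} (\<lambda>t. (cmod (h (of_real r * cis t)))\<^sup>2) \<le> K"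
        using K[of r] r by simp
      show "\<bar>cmod (?k r t)\<bar> \<le> B * M + A" for t
      proof -
        note d = disc[OF r, of t]
        have "0 \<le> B" by (rule order_trans[OF norm_ge_zero G(2)[OF d]])
        have "cmod (?k r t) \<le> cmod (G (of_real r * cis t)) * cmod (\<phi> (of_real r * cis t))
            + cmod (F (of_real r * cis t))"
          by (rule order_trans[OF norm_triangle_ineq4]) (simp add: norm_mult)
        also have "\<dots> \<le> B * M + A"
          by (intro add_mono mult_mono F(2) G(2) \<phi>(2) d \<open>0 \<le> B\<close> norm_ge_zero)
        finally show ?thesis by simp
      qed
    next
      show "AE t in lborel. ((\<lambda>r. cmod (?k r t)) \<longlongrightarrow> 0) (at_left 1)"
        using boundary
      proof eventually_elim
        case (elim t)
        then obtain u p where u: "((\<lambda>r. F (of_real r * cis t)) \<longlongrightarrow> u) (at_left 1)"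
          and p: "((\<lambda>r. \<phi> (of_real r * cis t)) \<longlongrightarrow> p) (at_left 1)" "cmod p = 1"
          and g: "((\<lambda>r. G (of_real r * cis t)) \<longlongrightarrow> cnj u * p) (at_left 1)"
          by (auto simp: radial_lim_def)
        have "((\<lambda>r. cmod (?k r t)) \<longlongrightarrow> cmod (cnj u * p * cnj p - cnj u)) (at_left 1)"
          by (intro tendsto_intros u p g)
        moreover have "p * cnj p = 1"
          using p(2) by (simp add: complex_norm_square[symmetric])
        ultimately show ?case
          by (simp add: mult.assoc)
      qed
    qed
    have Fh: "integral {0..2 * pi} (\<lambda>t. cnj (F (of_real r * cis t)
        * (of_real r * cis t * h (of_real r * cis t)))) = 0" if r: "0 < r" "r < 1" for r
    proof -
      have "circle_mean (\<lambda>w. F (of_real r * w) * (of_real r * w * h (of_real r * w)))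
          = F 0 * (0 * h 0)"
        using F(1) h r by (intro circle_mean_eq_centre[of "\<lambda>w. F w * (w * h w)"]) (auto intro!: holomorphic_intros)
      then have "integral {0..2 * pi} (\<lambda>t. F (of_real r * cis t)
          * (of_real r * cis t * h (of_real r * cis t))) = 0"
        by (simp add: circle_mean_def)
      then show ?thesis
        by (simp only: integral_cnj[symmetric] complex_cnj_zero)
    qed
    let ?I = "\<lambda>r. circle_mean (\<lambda>w. G (of_real r * w) *
        cnj (of_real r * w * \<phi> (of_real r * w) * h (of_real r * w)))"
    have bound: "cmod (?I r) \<le> 1 / (2 * pi) *
        integral {0..2 * pi} (\<lambda>t. \<bar>cmod (?k r t)\<bar> * \<bar>cmod (h (of_real r * cis t))\<bar>)"
      if r: "0 < r" "r < 1" for r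
    proof -
      note c = cont[OF r]
      let ?zh = "\<lambda>t. of_real r * cis t * h (of_real r * cis t)"
      have "integral {0..2 * pi} (\<lambda>t. G (of_real r * cis t) *
              cnj (of_real r * cis t * \<phi> (of_real r * cis t) * h (of_real r * cis t)))
          = integral {0..2 * pi} (\<lambda>t. ?k r t * cnj (?zh t) + cnj (F (of_real r * cis t) * ?zh t))"
        by (simp add: algebra_simps)
      also have "\<dots> = integral {0..2 * pi} (\<lambda>t. ?k r t * cnj (?zh t))
          + integral {0..2 * pi} (\<lambda>t. cnj (F (of_real r * cis t) * ?zh t))"
        by (intro integral_add integrable_continuous_real continuous_intros c)
      also have "\<dots> = integral {0..2 * pi} (\<lambda>t. ?k r t * cnj (?zh t))"
        using Fh[OF r] by simp
      finally have "cmod (integral {0..2 * pi} (\<lambda>t. G (of_real r * cis t) *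
              cnj (of_real r * cis t * \<phi> (of_real r * cis t) * h (of_real r * cis t))))
          = cmod (integral {0..2 * pi} (\<lambda>t. ?k r t * cnj (?zh t)))" by simp
      also have "\<dots> \<le> integral {0..2 * pi}
          (\<lambda>t. \<bar>cmod (?k r t)\<bar> * \<bar>cmod (h (of_real r * cis t))\<bar>)"
      proof (rule integral_norm_bound_integral)
        show "cmod (?k r t * cnj (?zh t)) \<le> \<bar>cmod (?k r t)\<bar> * \<bar>cmod (h (of_real r * cis t))\<bar>" for t
        proof -
          have "r * cmod (h (of_real r * cis t)) \<le> 1 * cmod (h (of_real r * cis t))"
            using r by (intro mult_right_mono) auto
          then have "cmod (?zh t) \<le> cmod (h (of_real r * cis t))"
            using r by (simp add: norm_mult)
          then show ?thesis
            by (simp only: norm_mult complex_mod_cnj abs_norm_cancel) (intro mult_left_mono norm_ge_zero)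
        qed
      qed (intro integrable_continuous_real continuous_intros c)+
      finally show ?thesis
        by (simp add: circle_mean_def field_simps)
    qed
    have "(?I \<longlongrightarrow> 0) (at_left 1)"
    proof (rule Lim_null_comparison)
      have "\<forall>\<^sub>F r in at_left (1::real). r \<in> {0<..<1}"
        by (intro eventually_at_left_real) auto
      then show "\<forall>\<^sub>F r in at_left 1. cmod (?I r) \<le> 1 / (2 * pi) *
          integral {0..2 * pi} (\<lambda>t. \<bar>cmod (?k r t)\<bar> * \<bar>cmod (h (of_real r * cis t))\<bar>)"
        by (rule eventually_mono) (rule bound; simp)
      show "((\<lambda>r. 1 / (2 * pi) * integral {0..2 * pi}
          (\<lambda>t. \<bar>cmod (?k r t)\<bar> * \<bar>cmod (h (of_real r * cis t))\<bar>)) \<longlongrightarrow> 0) (at_left 1)"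
        using tendsto_mult_left[OF lim, of "1 / (2 * pi)"] by simp
    qed
    then show ?thesis
      unfolding hardy2_inner_def by (rule tendsto_Lim[OF trivial_limit_at_left_real])
  qed
  moreover have "G \<in> hardy2"
    using G by (rule bounded_holomorphic_in_hardy2)
  ultimately show ?thesis by (simp add: model_space_def)
qed

text \<open>The defining property of \<open>conj_map\<close> has a solution, namely \<open>G\<close>, and two solutions have a
  difference in \<open>H\<^sup>2\<close> with vanishing boundary values, so that every choice agrees with \<open>G\<close> on
  the disc.\<close>

lemma conj_map_bounded:
  assumes F: "F holomorphic_on unit_disc" "\<And>z. z \<in> unit_disc \<Longrightarrow> cmod (F z) \<le> A"
    and G: "G holomorphic_on unit_disc" "\<And>z. z \<in> unit_disc \<Longrightarrow> cmod (G z) \<le> B"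
    and \<phi>: "\<phi> holomorphic_on unit_disc" "\<And>z. z \<in> unit_disc \<Longrightarrow> cmod (\<phi> z) \<le> M"
    and boundary: "AE t in lborel. \<exists>u p. radial_lim F (cis t) u \<and> radial_lim \<phi> (cis t) p \<and>
          cmod p = 1 \<and> radial_lim G (cis t) (cnj u * p)"
    and z: "z \<in> unit_disc"
  shows "conj_map \<phi> F z = G z"
proof -
  let ?P = "\<lambda>g. g \<in> model_space \<phi> \<and>
     (AE t in lborel. \<exists>u p. radial_lim F (cis t) u \<and> radial_lim \<phi> (cis t) p \<and>
                            radial_lim g (cis t) (cnj u * p))"
  have G_model: "G \<in> model_space \<phi>"
    using F G \<phi> boundary by (rule bounded_conjugate_in_model_space)
  moreover have "AE t in lborel. \<exists>u p. radial_lim F (cis t) u \<and> radial_lim \<phi> (cis t) p \<and>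
                            radial_lim G (cis t) (cnj u * p)"
    using boundary by eventually_elim blast
  ultimately have C: "?P (conj_map \<phi> F)"
    unfolding conj_map_def by (intro someI[of ?P G] conjI)
  have "(\<lambda>z. conj_map \<phi> F z - G z) \<in> hardy2"
    using C G_model by (intro hardy2_diff) (auto simp: model_space_def)
  moreover have "AE t in lborel. radial_lim (\<lambda>z. conj_map \<phi> F z - G z) (cis t) 0"
    using C[THEN conjunct2] boundary
  proof eventually_elim
    case (elim t)
    then obtain u p u' p' where
      *: "radial_lim F (cis t) u" "radial_lim \<phi> (cis t) p" "radial_lim (conj_map \<phi> F) (cis t) (cnj u * p)"
        "radial_lim F (cis t) u'" "radial_lim \<phi> (cis t) p'" "radial_lim G (cis t) (cnj u' * p')"
      by blast
    then have "u' = u" "p' = p"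
      using radial_lim_unique by blast+
    then have "radial_lim G (cis t) (cnj u * p)"
      using *(6) by simp
    from tendsto_diff[OF *(3)[unfolded radial_lim_def] this[unfolded radial_lim_def]]
    show ?case
      by (simp add: radial_lim_def)
  qed
  ultimately have "conj_map \<phi> F z - G z = 0"
    using z by (rule hardy2_eq_0_if_radial_lim_0)
  then show ?thesis by simp
qed

section \<open>Two-by-two unitary matrices\<close>

text \<open>The matrix with rows \<open>(p, q)\<close> and \<open>(r, s)\<close> has orthonormal columns, so its inverse is its
  adjoint; comparing the adjoint with the adjugate divided by the determinant \<open>e\<close> gives the second
  row in terms of the first.\<close>

lemma unitary_2x2_entries:
  fixes p q r s :: complex
  assumes "cnj p * p + cnj r * r = 1" "cnj q * q + cnj s * s = 1" "cnj p * q + cnj r * s = 0"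
  defines "e \<equiv> p * s - q * r"
  shows "s = e * cnj p" "r = - e * cnj q" "cmod e = 1"
proof -
  have conj: "p * cnj q + r * cnj s = 0"
    using arg_cong[OF assms(3), of cnj] by simp
  show "s = e * cnj p"
    using assms(1,3) unfolding e_def by algebra
  show "r = - e * cnj q"
    using assms(2) conj unfolding e_def by algebra
  have "e * cnj e = 1"
    unfolding e_def complex_cnj_diff complex_cnj_mult
    using assms(1-3) conj by algebra
  then have "complex_of_real ((cmod e)\<^sup>2) = 1"
    by (simp add: complex_norm_square[symmetric])
  then have "(cmod e)\<^sup>2 = 1"
    by (simp only: of_real_eq_1_iff)
  then show "cmod e = 1"
    using norm_ge_zero[of e] by (auto simp: power2_eq_1_iff)
qed

lemma norm_vec2_squared: "(norm (v :: complex^2))\<^sup>2 = (cmod (v $ 1))\<^sup>2 + (cmod (v $ 2))\<^sup>2"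
  by (simp add: norm_vec_def L2_set_def sum_2)

lemma isometric_2x2_columns:
  fixes L :: "complex^2^2"
  assumes "\<And>v. norm (L *v v) = norm v"
  shows "cnj (L $ 1 $ 1) * L $ 1 $ 1 + cnj (L $ 2 $ 1) * L $ 2 $ 1 = 1"
    "cnj (L $ 1 $ 2) * L $ 1 $ 2 + cnj (L $ 2 $ 2) * L $ 2 $ 2 = 1"
    "cnj (L $ 1 $ 1) * L $ 1 $ 2 + cnj (L $ 2 $ 1) * L $ 2 $ 2 = 0"
proof -
  define p q r s where "p = L $ 1 $ 1" and "q = L $ 1 $ 2" and "r = L $ 2 $ 1" and "s = L $ 2 $ 2"
  have iso: "(p * x + q * y) * cnj (p * x + q * y) + (r * x + s * y) * cnj (r * x + s * y)
      = x * cnj x + y * cnj y" for x y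
  proof -
    have "(norm (L *v vector [x, y]))\<^sup>2 = (norm (vector [x, y] :: complex^2))\<^sup>2"
      using assms by simp
    then have "(cmod (p * x + q * y))\<^sup>2 + (cmod (r * x + s * y))\<^sup>2 = (cmod x)\<^sup>2 + (cmod y)\<^sup>2"
      by (simp add: norm_vec2_squared matrix_vector_mult_def sum_2 p_def q_def r_def s_def)
    then have "complex_of_real ((cmod (p * x + q * y))\<^sup>2 + (cmod (r * x + s * y))\<^sup>2)
        = complex_of_real ((cmod x)\<^sup>2 + (cmod y)\<^sup>2)" by simp
    then show ?thesis
      by (simp only: of_real_add complex_norm_square)
  qed
  have 1: "p * cnj p + r * cnj r = 1" using iso[of 1 0] by simp
  have 2: "q * cnj q + s * cnj s = 1" using iso[of 0 1] by simp
  \<comment> \<open>Polarization: the two remaining test vectors give the real and the imaginary part of the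
    inner product of the columns.\<close>
  have 3: "(p + q) * (cnj p + cnj q) + (r + s) * (cnj r + cnj s) = 2"
    using iso[of 1 1] by simp
  have 4: "(p + q * \<i>) * (cnj p - cnj q * \<i>) + (r + s * \<i>) * (cnj r - cnj s * \<i>) = 2"
    using iso[of 1 \<i>] by simp
  have "\<i> * \<i> = - 1" by simp
  then have "2 * (cnj p * q + cnj r * s) = 0"
    using 1 2 3 4 by algebra
  then have "cnj p * q + cnj r * s = 0"
    by (metis mult_eq_0_iff zero_neq_numeral)
  then show "cnj (L $ 1 $ 1) * L $ 1 $ 2 + cnj (L $ 2 $ 1) * L $ 2 $ 2 = 0"
    by (simp add: p_def q_def r_def s_def)
  show "cnj (L $ 1 $ 1) * L $ 1 $ 1 + cnj (L $ 2 $ 1) * L $ 2 $ 1 = 1"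
    "cnj (L $ 1 $ 2) * L $ 1 $ 2 + cnj (L $ 2 $ 2) * L $ 2 $ 2 = 1"
    using 1 2 by (simp_all add: p_def q_def r_def s_def mult.commute)
qed

lemma unitary_matrix_2x2_columns:
  assumes "unitary_matrix V"
  shows "cnj (V $ 1 $ 1) * V $ 1 $ 1 + cnj (V $ 2 $ 1) * V $ 2 $ 1 = 1"
    "cnj (V $ 1 $ 2) * V $ 1 $ 2 + cnj (V $ 2 $ 2) * V $ 2 $ 2 = 1"
    "cnj (V $ 1 $ 1) * V $ 1 $ 2 + cnj (V $ 2 $ 1) * V $ 2 $ 2 = 0"
  using assms
  by (simp_all add: unitary_matrix_def adjoint_matrix_def vec_eq_iff matrix_matrix_mult_def
      mat_def sum_2 forall_2)

lemma adjoint_matrix_mult: "adjoint_matrix (A ** B) = adjoint_matrix B ** adjoint_matrix A"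
  by (simp add: adjoint_matrix_def vec_eq_iff matrix_matrix_mult_def mult.commute)

lemma unitary_matrix_mult:
  assumes "unitary_matrix A" "unitary_matrix B"
  shows "unitary_matrix (A ** B)"
proof -
  have "adjoint_matrix B ** adjoint_matrix A ** (A ** B)
      = adjoint_matrix B ** (adjoint_matrix A ** A) ** B"
    "A ** B ** (adjoint_matrix B ** adjoint_matrix A)
      = A ** (B ** adjoint_matrix B) ** adjoint_matrix A"
    by (simp_all only: matrix_mul_assoc)
  with assms show ?thesis
    by (simp add: unitary_matrix_def adjoint_matrix_mult)
qed

lemma unitary_matrix_transpose_adjoint:
  assumes "unitary_matrix U"
  shows "unitary_matrix (transpose (adjoint_matrix U))"
proof -
  have "adjoint_matrix (transpose (adjoint_matrix U)) = transpose U"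
    by (simp add: adjoint_matrix_def transpose_def vec_eq_iff)
  then show ?thesis
    using assms by (simp add: unitary_matrix_def matrix_transpose_mul[symmetric])
qed

lemma unitary_matrix_one: "unitary_matrix (mat 1)"
  by (simp add: unitary_matrix_def adjoint_matrix_def vec_eq_iff matrix_matrix_mult_def
      mat_def sum_2 forall_2)

text \<open>The right factor \<open>U2\<close> is moved to the left by the congruence with
  \<open>P = transpose (adjoint_matrix U2)\<close>, whose transpose is the inverse of \<open>U2\<close>.\<close>

lemma symmetrizable_iff_left:
  "symmetrizable \<Theta> \<longleftrightarrow>
    (\<exists>V. unitary_matrix V \<and> (\<forall>z \<in> unit_disc. transpose (V ** \<Theta> z) = V ** \<Theta> z))"
proof
  assume "symmetrizable \<Theta>"
  then obtain U1 U2 where U: "unitary_matrix U1" "unitary_matrix U2"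
    and sym: "\<And>z. z \<in> unit_disc \<Longrightarrow> transpose (U1 ** \<Theta> z ** U2) = U1 ** \<Theta> z ** U2"
    unfolding symmetrizable_def by blast
  define P where "P = transpose (adjoint_matrix U2)"
  have "transpose (P ** U1 ** \<Theta> z) = P ** U1 ** \<Theta> z" if "z \<in> unit_disc" for z
  proof -
    have "P ** U1 ** \<Theta> z = P ** (U1 ** \<Theta> z ** (U2 ** adjoint_matrix U2))"
      using U(2) by (simp add: unitary_matrix_def matrix_mul_assoc)
    also have "\<dots> = P ** (U1 ** \<Theta> z ** U2) ** transpose P"
      by (simp add: P_def matrix_mul_assoc)
    finally have *: "P ** U1 ** \<Theta> z = P ** (U1 ** \<Theta> z ** U2) ** transpose P" .
    show ?thesis
      unfolding * matrix_transpose_mul[of "P ** _"] matrix_transpose_mul[of P] sym[OF that]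
      by (simp add: matrix_mul_assoc)
  qed
  moreover have "unitary_matrix (P ** U1)"
    using U by (simp add: P_def unitary_matrix_mult unitary_matrix_transpose_adjoint)
  ultimately show "\<exists>V. unitary_matrix V \<and> (\<forall>z \<in> unit_disc. transpose (V ** \<Theta> z) = V ** \<Theta> z)"
    by blast
next
  assume "\<exists>V. unitary_matrix V \<and> (\<forall>z \<in> unit_disc. transpose (V ** \<Theta> z) = V ** \<Theta> z)"
  then obtain V where "unitary_matrix V" "\<forall>z \<in> unit_disc. transpose (V ** \<Theta> z) = V ** \<Theta> z"
    by blast
  then show "symmetrizable \<Theta>"
    unfolding symmetrizable_def
    by (intro exI[of _ V] exI[of _ "mat 1"]) (simp add: unitary_matrix_one)
qed

text \<open>A \<open>2\<times>2\<close> matrix is symmetric iff its two off-diagonal entries agree, and for \<open>V ** \<Theta> z\<close> this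
  is a linear equation in \<open>x z\<close>, \<open>y z\<close>, \<open>u z\<close>, \<open>v z\<close> whose coefficients are the entries of \<open>V\<close>.
  The form of a unitary \<open>V\<close> makes the coefficients of \<open>u\<close>, \<open>v\<close> conjugate to those of \<open>x\<close>, \<open>y\<close>
  up to a common phase, which a scalar factor removes.\<close>

lemma exists_unitary_symmetric_iff:
  fixes x y u v :: "'a \<Rightarrow> complex" and \<Theta> :: "'a \<Rightarrow> complex^2^2"
  assumes \<Theta>: "\<And>z. z \<in> S \<Longrightarrow> \<Theta> z = vector [vector [x z, - y z], vector [v z, u z]]"
  shows "(\<exists>V. unitary_matrix V \<and> (\<forall>z \<in> S. transpose (V ** \<Theta> z) = V ** \<Theta> z)) \<longleftrightarrow>
    (\<exists>\<gamma> \<theta>. (\<gamma>, \<theta>) \<noteq> (0, 0) \<and> (\<forall>z \<in> S. cnj \<gamma> * u z + cnj \<theta> * v z = \<gamma> * x z + \<theta> * y z))"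
    (is "?L \<longleftrightarrow> ?R")
proof -
  have sym: "transpose (V ** \<Theta> z) = V ** \<Theta> z \<longleftrightarrow>
      V $ 1 $ 2 * u z - V $ 1 $ 1 * y z = V $ 2 $ 1 * x z + V $ 2 $ 2 * v z" if "z \<in> S" for V z
    using \<Theta>[OF that]
    by (auto simp: vec_eq_iff forall_2 transpose_def matrix_matrix_mult_def sum_2)
  show ?thesis
  proof
    assume ?L
    then obtain V where V: "unitary_matrix V"
      and symV: "\<And>z. z \<in> S \<Longrightarrow> transpose (V ** \<Theta> z) = V ** \<Theta> z" by blast
    define p q where "p = V $ 1 $ 1" and "q = V $ 1 $ 2"
    define e where "e = p * V $ 2 $ 2 - q * V $ 2 $ 1"
    have row2: "V $ 2 $ 2 = e * cnj p" "V $ 2 $ 1 = - e * cnj q" and e: "cmod e = 1"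
      using unitary_2x2_entries[OF unitary_matrix_2x2_columns[OF V]]
      by (simp_all add: e_def p_def q_def)
    \<comment> \<open>The equation is \<open>q * u - p * y = e * (cnj p * v - cnj q * x)\<close>. Multiplied by \<open>l\<close>, it has the
      required form as soon as \<open>cnj l = - l * e\<close>.\<close>
    define l where "l = csqrt (- cnj e)"
    have l2: "l * l = - cnj e"
      using power2_csqrt[of "- cnj e"] by (simp add: l_def power2_eq_square)
    have e1: "e * cnj e = 1" using e by (simp add: complex_norm_square[symmetric])
    have cl: "cnj l = - l * e"
    proof -
      have "cmod l * cmod l = 1"
        using arg_cong[OF l2, of cmod] e by (simp add: norm_mult)
      then have "l * cnj l = 1"
        by (simp add: complex_norm_square[symmetric] power2_eq_square flip: of_real_mult)
      then show ?thesis using l2 e1 by algebra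
    qed
    have "e \<noteq> 0" using e by auto
    have "l \<noteq> 0" using l2 e by auto
    have "(cnj l * cnj q, l * p) \<noteq> (0, 0)"
    proof
      assume "(cnj l * cnj q, l * p) = (0, 0)"
      then have "p = 0" "q = 0" using \<open>l \<noteq> 0\<close> by auto
      with \<open>e \<noteq> 0\<close> show False by (simp add: e_def)
    qed
    moreover have "cnj (cnj l * cnj q) * u z + cnj (l * p) * v z = cnj l * cnj q * x z + l * p * y z"
      if "z \<in> S" for z
    proof -
      have "q * u z - p * y z = - e * cnj q * x z + e * cnj p * v z"
        using symV[OF that] unfolding sym[OF that] row2 p_def[symmetric] q_def[symmetric] .
      then have "l * (q * u z - p * y z) = l * (- e * cnj q * x z + e * cnj p * v z)"
        by simp
      then show ?thesis
        unfolding complex_cnj_mult complex_cnj_cnj unfolding cl by (simp add: algebra_simps)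
    qed
    ultimately show ?R by blast
  next
    assume ?R
    then obtain \<gamma> \<theta> where nz: "(\<gamma>, \<theta>) \<noteq> (0, 0)"
      and fix': "\<And>z. z \<in> S \<Longrightarrow> cnj \<gamma> * u z + cnj \<theta> * v z = \<gamma> * x z + \<theta> * y z" by blast
    define n where "n = sqrt ((cmod \<gamma>)\<^sup>2 + (cmod \<theta>)\<^sup>2)"
    have "n > 0" using nz by (auto simp: n_def add_pos_nonneg add_nonneg_pos)
    define g h where "g = \<gamma> / of_real n" and "h = \<theta> / of_real n"
    have one: "g * cnj g + h * cnj h = 1"
    proof -
      have "g * cnj g + h * cnj h = (\<gamma> * cnj \<gamma> + \<theta> * cnj \<theta>) / (of_real n)\<^sup>2"
        by (simp add: g_def h_def add_divide_distrib power2_eq_square)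
      also have "\<dots> = of_real (((cmod \<gamma>)\<^sup>2 + (cmod \<theta>)\<^sup>2) / n\<^sup>2)"
        by (simp add: complex_norm_square[symmetric])
      also have "((cmod \<gamma>)\<^sup>2 + (cmod \<theta>)\<^sup>2) / n\<^sup>2 = 1"
      proof -
        have "(cmod \<gamma>)\<^sup>2 + (cmod \<theta>)\<^sup>2 = n\<^sup>2" by (simp add: n_def)
        then show ?thesis using \<open>n > 0\<close> by simp
      qed
      finally show ?thesis by simp
    qed
    \<comment> \<open>First row \<open>(h, cnj g)\<close> and determinant \<open>-1\<close>, so that no phase has to be corrected.\<close>
    define V :: "complex^2^2" where "V = vector [vector [h, cnj g], vector [g, - cnj h]]"
    have "unitary_matrix V"
      using one
      by (simp add: unitary_matrix_def adjoint_matrix_def vec_eq_iff matrix_matrix_mult_def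
          mat_def sum_2 forall_2 V_def algebra_simps)
    moreover have "transpose (V ** \<Theta> z) = V ** \<Theta> z" if "z \<in> S" for z
    proof -
      have "(cnj \<gamma> * u z + cnj \<theta> * v z) / of_real n = (\<gamma> * x z + \<theta> * y z) / of_real n"
        using fix'[OF that] by simp
      then have "cnj g * u z + cnj h * v z = g * x z + h * y z"
        by (simp add: g_def h_def add_divide_distrib)
      then show ?thesis
        unfolding sym[OF that] by (simp add: V_def algebra_simps)
    qed
    ultimately show ?L by blast
  qed
qed

section \<open>Symmetrizable inner functions\<close>

lemma norm_entry_le_onorm:
  fixes A :: "complex^'n^'m"
  shows "cmod (A $ i $ j) \<le> onorm (\<lambda>v. A *v v)"
proof -
  have "A $ i $ j = (A *v axis j 1) $ i"
    by (simp add: matrix_vector_mult_def axis_def if_distrib cong: if_cong)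
  then have "cmod (A $ i $ j) \<le> norm (A *v axis j 1)"
    by (simp add: Finite_Cartesian_Product.norm_nth_le)
  also have "\<dots> \<le> onorm (\<lambda>v. A *v v) * norm (axis j 1 :: complex^'n)"
    by (rule onorm) (rule matrix_vector_mul_bounded_linear)
  finally show ?thesis by simp
qed

theorem theorem4p3:
  fixes \<Theta> :: "complex \<Rightarrow> complex^2^2" and \<phi> a b :: "complex \<Rightarrow> complex"
  assumes "inner_matrix_fun \<Theta>"
    and "\<forall>z \<in> unit_disc. \<phi> z = det (\<Theta> z)"
    and "a \<in> model_space \<phi>" and "b \<in> model_space \<phi>"
    and "\<forall>z \<in> unit_disc. \<Theta> z = vector [vector [a z, - b z],
                                        vector [conj_map \<phi> b z, conj_map \<phi> a z]]"
  shows "symmetrizable \<Theta> \<longleftrightarrow>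
    (\<exists>\<gamma> \<theta> :: complex. (\<gamma>, \<theta>) \<noteq> (0, 0) \<and>
      (\<forall>z \<in> unit_disc. conj_map \<phi> (\<lambda>z. \<gamma> * a z + \<theta> * b z) z = \<gamma> * a z + \<theta> * b z))"
proof -
  define c d where "c = conj_map \<phi> b" and "d = conj_map \<phi> a"
  have \<Theta>: "\<Theta> z = vector [vector [a z, - b z], vector [c z, d z]]" if "z \<in> unit_disc" for z
    using assms(5) that by (simp add: c_def d_def)
  have entry_hol: "(\<lambda>z. \<Theta> z $ i $ j) holomorphic_on unit_disc" for i j
    using assms(1) by (simp add: inner_matrix_fun_def)
  have entry_le: "cmod (\<Theta> z $ i $ j) \<le> 1" if "z \<in> unit_disc" for z i j
  proof -
    have "onorm (\<lambda>v. \<Theta> z *v v) \<le> 1"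
      using assms(1) that by (simp add: inner_matrix_fun_def)
    then show ?thesis
      using norm_entry_le_onorm[of "\<Theta> z" i j] by linarith
  qed
  have hol: "a holomorphic_on unit_disc" "b holomorphic_on unit_disc"
    "c holomorphic_on unit_disc" "d holomorphic_on unit_disc"
  proof -
    show "a holomorphic_on unit_disc"
      by (rule holomorphic_transform[OF entry_hol[of 1 1]]) (simp add: \<Theta>)
    show "b holomorphic_on unit_disc"
      by (rule holomorphic_transform[OF holomorphic_on_minus[OF entry_hol[of 1 2]]]) (simp add: \<Theta>)
    show "c holomorphic_on unit_disc"
      by (rule holomorphic_transform[OF entry_hol[of 2 1]]) (simp add: \<Theta>)
    show "d holomorphic_on unit_disc"
      by (rule holomorphic_transform[OF entry_hol[of 2 2]]) (simp add: \<Theta>)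
  qed
  have le: "cmod (a z) \<le> 1" "cmod (b z) \<le> 1" "cmod (c z) \<le> 1" "cmod (d z) \<le> 1"
    if "z \<in> unit_disc" for z
    using entry_le[OF that, of 1 1] entry_le[OF that, of 1 2] entry_le[OF that, of 2 1]
      entry_le[OF that, of 2 2] by (simp_all add: \<Theta>[OF that])
  have \<phi>: "\<phi> z = a z * d z + b z * c z" if "z \<in> unit_disc" for z
    using assms(2) that by (simp add: det_2 \<Theta>)
  have \<phi>_hol: "\<phi> holomorphic_on unit_disc"
    by (rule holomorphic_transform[of "\<lambda>z. a z * d z + b z * c z"])
       (auto intro!: holomorphic_intros hol simp: \<phi>)
  have \<phi>_le: "cmod (\<phi> z) \<le> 1 * 1 + 1 * 1" if "z \<in> unit_disc" for z
    unfolding \<phi>[OF that]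
    by (rule order_trans[OF norm_triangle_ineq], unfold norm_mult)
       (intro add_mono mult_mono le that norm_ge_zero zero_le_one)
  \<comment> \<open>At almost every point the limit matrix is unitary with determinant \<open>p\<close>, so that its second row
    is determined by its first row \<open>(u, - v)\<close>.\<close>
  have boundary: "AE t in lborel. \<exists>u v p. radial_lim a (cis t) u \<and> radial_lim b (cis t) v \<and>
      radial_lim \<phi> (cis t) p \<and> cmod p = 1 \<and>
      radial_lim d (cis t) (cnj u * p) \<and> radial_lim c (cis t) (cnj v * p)"
  proof -
    have "AE t in lborel. \<exists>L. radial_lim \<Theta> (cis t) L \<and> (\<forall>v. norm (L *v v) = norm v)"
      using assms(1) by (simp add: inner_matrix_fun_def)
    then show ?thesis
    proof eventually_elim
      case (elim t)
      then obtain L where L: "((\<lambda>r. \<Theta> (of_real r * cis t)) \<longlongrightarrow> L) (at_left 1)"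
        and iso: "\<And>v. norm (L *v v) = norm v" by (auto simp: radial_lim_def)
      have entry: "((\<lambda>r. \<Theta> (of_real r * cis t) $ i $ j) \<longlongrightarrow> L $ i $ j) (at_left 1)" for i j
        by (intro tendsto_vec_nth L)
      have "\<forall>\<^sub>F r in at_left (1::real). r \<in> {0<..<1}"
        by (intro eventually_at_left_real) auto
      then have disc: "\<forall>\<^sub>F r in at_left (1::real). of_real r * cis t \<in> unit_disc"
        by (rule eventually_mono) (simp add: norm_mult)
      have lim: "radial_lim f (cis t) l"
        if "((\<lambda>r. F (of_real r * cis t)) \<longlongrightarrow> l) (at_left 1)" "\<And>z. z \<in> unit_disc \<Longrightarrow> F z = f z"
        for f F :: "complex \<Rightarrow> complex" and l
        unfolding radial_lim_def
      proof (rule Lim_transform_eventually[OF that(1)])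
        show "\<forall>\<^sub>F r in at_left 1. F (of_real r * cis t) = f (of_real r * cis t)"
          using disc by (rule eventually_mono) (rule that(2))
      qed
      have a: "radial_lim a (cis t) (L $ 1 $ 1)"
        by (rule lim[where F = "\<lambda>z. \<Theta> z $ 1 $ 1", OF entry]) (simp add: \<Theta>)
      have b: "radial_lim b (cis t) (- L $ 1 $ 2)"
        by (rule lim[where F = "\<lambda>z. - \<Theta> z $ 1 $ 2", OF tendsto_minus[OF entry]]) (simp add: \<Theta>)
      have c: "radial_lim c (cis t) (L $ 2 $ 1)"
        by (rule lim[where F = "\<lambda>z. \<Theta> z $ 2 $ 1", OF entry]) (simp add: \<Theta>)
      have d: "radial_lim d (cis t) (L $ 2 $ 2)"
        by (rule lim[where F = "\<lambda>z. \<Theta> z $ 2 $ 2", OF entry]) (simp add: \<Theta>)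
      define p where "p = L $ 1 $ 1 * L $ 2 $ 2 - L $ 1 $ 2 * L $ 2 $ 1"
      have p: "radial_lim \<phi> (cis t) p"
        unfolding p_def
        by (rule lim[where F = "\<lambda>z. \<Theta> z $ 1 $ 1 * \<Theta> z $ 2 $ 2 - \<Theta> z $ 1 $ 2 * \<Theta> z $ 2 $ 1"],
            intro tendsto_intros entry) (simp add: \<phi> \<Theta>)
      have *: "L $ 2 $ 2 = p * cnj (L $ 1 $ 1)" "L $ 2 $ 1 = - p * cnj (L $ 1 $ 2)" "cmod p = 1"
        unfolding p_def by (rule unitary_2x2_entries[OF isometric_2x2_columns[OF iso]])+
      show ?case
      proof (rule exI[of _ "L $ 1 $ 1"], rule exI[of _ "- L $ 1 $ 2"], rule exI[of _ p], intro conjI)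
        show "radial_lim d (cis t) (cnj (L $ 1 $ 1) * p)"
          using d by (simp add: *(1) mult.commute)
        show "radial_lim c (cis t) (cnj (- L $ 1 $ 2) * p)"
          using c by (simp add: *(2) mult.commute)
      qed (fact a b p *(3))+
    qed
  qed
  \<comment> \<open>Antilinearity of the conjugation on the span of \<open>a\<close> and \<open>b\<close>.\<close>
  have C: "conj_map \<phi> (\<lambda>z. \<gamma> * a z + \<theta> * b z) z = cnj \<gamma> * d z + cnj \<theta> * c z"
    if z: "z \<in> unit_disc" for \<gamma> \<theta> z
  proof (rule conj_map_bounded[where F = "\<lambda>z. \<gamma> * a z + \<theta> * b z"
        and G = "\<lambda>z. cnj \<gamma> * d z + cnj \<theta> * c z" and \<phi> = \<phi>])
    show "\<phi> holomorphic_on unit_disc" by (rule \<phi>_hol)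
    show "cmod (\<phi> z) \<le> 1 * 1 + 1 * 1" if "z \<in> unit_disc" for z
      using that by (rule \<phi>_le)
    show "z \<in> unit_disc" by (rule z)
    show "(\<lambda>z. \<gamma> * a z + \<theta> * b z) holomorphic_on unit_disc"
      "(\<lambda>z. cnj \<gamma> * d z + cnj \<theta> * c z) holomorphic_on unit_disc"
      by (intro holomorphic_intros hol)+
    show "cmod (\<gamma> * a z + \<theta> * b z) \<le> cmod \<gamma> * 1 + cmod \<theta> * 1" if "z \<in> unit_disc" for z
      by (rule order_trans[OF norm_triangle_ineq], unfold norm_mult)
         (intro add_mono mult_left_mono le that norm_ge_zero)
    show "cmod (cnj \<gamma> * d z + cnj \<theta> * c z) \<le> cmod \<gamma> * 1 + cmod \<theta> * 1" if "z \<in> unit_disc" for z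
      by (rule order_trans[OF norm_triangle_ineq], unfold norm_mult complex_mod_cnj)
         (intro add_mono mult_left_mono le that norm_ge_zero)
    show "AE t in lborel. \<exists>u p. radial_lim (\<lambda>z. \<gamma> * a z + \<theta> * b z) (cis t) u \<and>
        radial_lim \<phi> (cis t) p \<and> cmod p = 1 \<and>
        radial_lim (\<lambda>z. cnj \<gamma> * d z + cnj \<theta> * c z) (cis t) (cnj u * p)"
      using boundary
    proof eventually_elim
      case (elim t)
      then obtain u v p where *: "radial_lim a (cis t) u" "radial_lim b (cis t) v"
        "radial_lim \<phi> (cis t) p" "cmod p = 1"
        "radial_lim d (cis t) (cnj u * p)" "radial_lim c (cis t) (cnj v * p)" by blast
      have "radial_lim (\<lambda>z. \<gamma> * a z + \<theta> * b z) (cis t) (\<gamma> * u + \<theta> * v)"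
        using *(1,2) unfolding radial_lim_def by (intro tendsto_intros)
      moreover have "radial_lim (\<lambda>z. cnj \<gamma> * d z + cnj \<theta> * c z) (cis t)
          (cnj \<gamma> * (cnj u * p) + cnj \<theta> * (cnj v * p))"
        using *(5,6) unfolding radial_lim_def by (intro tendsto_intros)
      moreover have "cnj \<gamma> * (cnj u * p) + cnj \<theta> * (cnj v * p) = cnj (\<gamma> * u + \<theta> * v) * p"
        by (simp add: algebra_simps)
      ultimately show ?case using *(3,4) by metis
    qed
  qed
  have "symmetrizable \<Theta> \<longleftrightarrow> (\<exists>\<gamma> \<theta>. (\<gamma>, \<theta>) \<noteq> (0, 0) \<and>
      (\<forall>z \<in> unit_disc. cnj \<gamma> * d z + cnj \<theta> * c z = \<gamma> * a z + \<theta> * b z))"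
    unfolding symmetrizable_iff_left by (rule exists_unitary_symmetric_iff) (rule \<Theta>)
  then show ?thesis by (simp add: C)
qed

end
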